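(* The variety $y^2=CM(x_{12},x_{13},x_{14},x_{23},x_{24},x_{34})$ is rational over $\mathbb{Q}(\sqrt{-1})$. Moreover, the variety $y^2=-CM(x_{12},x_{13},x_{14},x_{23},x_{24},x_{34})$ is rational over $\mathbb{Q}$.
   Context: Let $x_{12},x_{13},x_{14},x_{23},x_{24},x_{34}$ be six independent variables. Define the polynomial $CM\in\mathbb{Z}[x_{12},x_{13},x_{14},x_{23},x_{24},x_{34}]$ (homogeneous of degree $6$) by $$CM(x_{12},x_{13},x_{14},x_{23},x_{24},x_{34})=\frac12\det\begin{pmatrix}0&1&1&1&1\\1&0&x_{12}^2&x_{13}^2&x_{14}^2\\1&x_{12}^2&0&x_{23}^2&x_{24}^2\\1&x_{13}^2&x_{23}^2&0&x_{34}^2\\1&x_{14}^2&x_{24}^2&x_{34}^2&0\end{pmatrix}.$$ For a field $K$ of characteristic $0$ and a sign $\varepsilon\in\{1,-1\}$, the variety $y^2=\varepsilon\,CM(x_{12},x_{13},x_{14},x_{23},x_{24},x_{34})$ is a six-dimensional hypersurface in the seven-dimensional affine space with coordinates $x_{12},x_{13},x_{14},x_{23},x_{24},x_{34},y$. It is said to be rational over $K$ if there are six elements $\xi_1,\dots,\xi_6$ of its function field $$K(x_{12},x_{13},x_{14},x_{23},x_{24},x_{34})[y]/(y^2-\varepsilon\,CM(x_{12},x_{13},x_{14},x_{23},x_{24},x_{34}))$$ such that this field is equal to $K(\xi_1,\xi_2,\xi_3,\xi_4,\xi_5,\xi_6)$. Since the function field has transcendence degree $6$ over $K$, such $\xi_i$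 are automatically algebraically independent over $K$. *)

theory Defs
  imports
    "HOL-Algebra.Algebraic_Closure_Type"
    "HOL-Algebra.Generated_Fields"
    "HOL-Computational_Algebra.Fraction_Field"
    "Jordan_Normal_Form.Determinant"
begin

section \<open>The field $\mathbb{Q}(\sqrt{-1})$\<close>

text \<open>
  The smallest subfield of the complex numbers containing the imaginary unit, made into a type
  so that it can serve, like \<^typ>\<open>rat\<close>, as a coefficient field of type class \<^class>\<open>field_char_0\<close>.
\<close>

abbreviation Q_adjoin_i :: "complex set" where
  "Q_adjoin_i \<equiv> generate_field ring_of_type_algebra {\<i>}"

lemma Q_adjoin_i_one: "1 \<in> Q_adjoin_i"
  using generate_field.one[of ring_of_type_algebra "{\<i>}"] by (simp add: ring_of_type_algebra_def)

lemma Q_adjoin_i_add: "x \<in> Q_adjoin_i \<Longrightarrow> y \<in> Q_adjoin_i \<Longrightarrow> x + y \<in> Q_adjoin_i"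
  using generate_field.eng_add[of x ring_of_type_algebra "{\<i>}" y]
  by (simp add: ring_of_type_algebra_def)

lemma Q_adjoin_i_mult: "x \<in> Q_adjoin_i \<Longrightarrow> y \<in> Q_adjoin_i \<Longrightarrow> x * y \<in> Q_adjoin_i"
  using generate_field.eng_mult[of x ring_of_type_algebra "{\<i>}" y]
  by (simp add: ring_of_type_algebra_def)

lemma Q_adjoin_i_uminus:
  assumes "x \<in> Q_adjoin_i"
  shows "- x \<in> Q_adjoin_i"
proof -
  interpret field "ring_of_type_algebra :: complex ring" by (rule field_from_type_algebra)
  have "\<ominus>\<^bsub>ring_of_type_algebra\<^esub> x = - x"
    using minus_equality[of "- x" x] by (simp add: ring_of_type_algebra_def)
  then show ?thesis
    using generate_field.a_inv[OF assms] by simp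
qed

lemma Q_adjoin_i_zero: "0 \<in> Q_adjoin_i"
  using Q_adjoin_i_add[OF Q_adjoin_i_one Q_adjoin_i_uminus[OF Q_adjoin_i_one]] by simp

lemma Q_adjoin_i_inverse:
  assumes "x \<in> Q_adjoin_i"
  shows "inverse x \<in> Q_adjoin_i"
proof (cases "x = 0")
  case False
  interpret field "ring_of_type_algebra :: complex ring" by (rule field_from_type_algebra)
  have "inv\<^bsub>ring_of_type_algebra\<^esub> x = inverse x"
    using comm_inv_char[of x "inverse x"] False by (simp add: ring_of_type_algebra_def)
  then show ?thesis
    using generate_field.m_inv[OF assms] False by (simp add: ring_of_type_algebra_def)
qed (simp add: Q_adjoin_i_zero)

typedef gauss_rat = Q_adjoin_i
  using Q_adjoin_i_one by blast

setup_lifting type_definition_gauss_rat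

instantiation gauss_rat :: field
begin

lift_definition zero_gauss_rat :: gauss_rat is 0 by (rule Q_adjoin_i_zero)
lift_definition one_gauss_rat :: gauss_rat is 1 by (rule Q_adjoin_i_one)
lift_definition plus_gauss_rat :: "gauss_rat \<Rightarrow> gauss_rat \<Rightarrow> gauss_rat" is "(+)"
  by (rule Q_adjoin_i_add)
lift_definition uminus_gauss_rat :: "gauss_rat \<Rightarrow> gauss_rat" is uminus
  by (rule Q_adjoin_i_uminus)
lift_definition minus_gauss_rat :: "gauss_rat \<Rightarrow> gauss_rat \<Rightarrow> gauss_rat" is "(-)"
  using Q_adjoin_i_add Q_adjoin_i_uminus by fastforce
lift_definition times_gauss_rat :: "gauss_rat \<Rightarrow> gauss_rat \<Rightarrow> gauss_rat" is "(*)"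
  by (rule Q_adjoin_i_mult)
lift_definition inverse_gauss_rat :: "gauss_rat \<Rightarrow> gauss_rat" is inverse
  by (rule Q_adjoin_i_inverse)
lift_definition divide_gauss_rat :: "gauss_rat \<Rightarrow> gauss_rat \<Rightarrow> gauss_rat" is "(/)"
  using Q_adjoin_i_mult Q_adjoin_i_inverse by (simp add: divide_inverse)

instance
  by standard (transfer; simp add: algebra_simps divide_inverse)+

end

instance gauss_rat :: field_char_0
proof
  have "Rep_gauss_rat (of_nat n) = of_nat n" for n
    by (induction n) (simp_all add: zero_gauss_rat.rep_eq one_gauss_rat.rep_eq plus_gauss_rat.rep_eq)
  then show "inj (of_nat :: nat \<Rightarrow> gauss_rat)"
    by (metis injI of_nat_eq_iff)
qed


section \<open>The Cayley--Menger polynomial\<close>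

definition CM :: "'a::field \<Rightarrow> 'a \<Rightarrow> 'a \<Rightarrow> 'a \<Rightarrow> 'a \<Rightarrow> 'a \<Rightarrow> 'a" where
  "CM x12 x13 x14 x23 x24 x34 =
     1 / 2 * Determinant.det (mat_of_rows_list 5
       [[0, 1,     1,     1,     1    ],
        [1, 0,     x12^2, x13^2, x14^2],
        [1, x12^2, 0,     x23^2, x24^2],
        [1, x13^2, x23^2, 0,     x34^2],
        [1, x14^2, x24^2, x34^2, 0    ]])"


section \<open>The rational function field in six variables\<close>

text \<open>
  The polynomial ring in six variables is $K[x_{12}][x_{13}][x_{14}][x_{23}][x_{24}][x_{34}]$,
  with \<open>x\<^sub>3\<^sub>4\<close> the outermost variable.
\<close>

type_synonym 'k poly6 = "'k poly poly poly poly poly poly"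
type_synonym 'k ratfun6 = "'k poly6 fract"

definition ratfun_const :: "'k::field_char_0 \<Rightarrow> 'k ratfun6" where
  "ratfun_const c = Fract [:[:[:[:[:[:c:]:]:]:]:]:] 1"

definition X12 :: "'k::field_char_0 ratfun6" where "X12 = Fract [:[:[:[:[:[:0, 1:]:]:]:]:]:] 1"
definition X13 :: "'k::field_char_0 ratfun6" where "X13 = Fract [:[:[:[:[:0, 1:]:]:]:]:] 1"
definition X14 :: "'k::field_char_0 ratfun6" where "X14 = Fract [:[:[:[:0, 1:]:]:]:] 1"
definition X23 :: "'k::field_char_0 ratfun6" where "X23 = Fract [:[:[:0, 1:]:]:] 1"
definition X24 :: "'k::field_char_0 ratfun6" where "X24 = Fract [:[:0, 1:]:] 1"
definition X34 :: "'k::field_char_0 ratfun6" where "X34 = Fract [:0, 1:] 1"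


section \<open>The function field of the hypersurface and rationality\<close>

abbreviation ratfun_ring :: "'k::field_char_0 ratfun6 ring" where
  "ratfun_ring \<equiv> ring_of_type_algebra"

text \<open>
  The polynomial $y^2 - \varepsilon\,CM$ in $y$ over the rational function field; the polynomials
  of \<^theory>\<open>HOL-Algebra.Polynomials\<close> are coefficient lists starting with the leading coefficient.
\<close>

definition CM_hypersurface :: "int \<Rightarrow> 'k::field_char_0 ratfun6 list" where
  "CM_hypersurface \<epsilon> = [1, 0, - (of_int \<epsilon> * CM X12 X13 X14 X23 X24 X34)]"

definition CM_function_field :: "int \<Rightarrow> 'k::field_char_0 ratfun6 list set ring" where
  "CM_function_field \<epsilon> = rupture ratfun_ring (carrier ratfun_ring) (CM_hypersurface \<epsilon>)"

definition CM_function_field_const :: "int \<Rightarrow> 'k::field_char_0 \<Rightarrow> 'k ratfun6 list set" where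
  "CM_function_field_const \<epsilon> c =
     ring.rupture_surj ratfun_ring (carrier ratfun_ring) (CM_hypersurface \<epsilon>)
       (ring.poly_of_const ratfun_ring (ratfun_const c))"

definition CM_variety_rational :: "'k::field_char_0 itself \<Rightarrow> int \<Rightarrow> bool" where
  "CM_variety_rational _ \<epsilon> \<longleftrightarrow>
     (let L = (CM_function_field \<epsilon> :: 'k ratfun6 list set ring) in
      \<exists>\<xi>1\<in>carrier L. \<exists>\<xi>2\<in>carrier L. \<exists>\<xi>3\<in>carrier L.
      \<exists>\<xi>4\<in>carrier L. \<exists>\<xi>5\<in>carrier L. \<exists>\<xi>6\<in>carrier L.
        carrier L = generate_field L
          (range (CM_function_field_const \<epsilon> :: 'k \<Rightarrow> _) \<union> {\<xi>1, \<xi>2, \<xi>3, \<xi>4, \<xi>5, \<xi>6}))"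

end

theory Submission
  imports Defs
begin

text \<open>
  Put \<open>x12 = 1\<close> by homogeneity. As a quadratic in \<open>x34\<^sup>2\<close>, the polynomial \<open>- CM\<close> is
  \<open>(x34\<^sup>2 - m)\<^sup>2 - \<delta>\<close>, where \<open>4 \<delta> = (s\<^sup>2 - 1) (1 - d\<^sup>2) (S\<^sup>2 - 1) (1 - D\<^sup>2)\<close> is given by Heron's formula for
  the two faces through the edge 12, in terms of the sums \<open>s, S\<close> and the differences \<open>d, D\<close> of their
  other edges (\<open>CM_Heron\<close>, \<open>normalized_volume\<close>). So \<open>y\<^sup>2 = - CM\<close> has points over \<open>x34 = \<infinity>\<close>, and
  \<open>w = 2 (y + x34\<^sup>2 - m) / (S\<^sup>2 - 1)\<close> can replace \<open>y\<close> as a variable. For fixed \<open>d, D, w\<close> the equation then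
  is that of a quadric in \<open>s, S\<close> and \<open>t = 2 x34\<close>. With \<open>n = w + 1\<close> and \<open>S' = S - d D s / n\<close> it reads
  \<open>n w (t\<^sup>2 - n S'\<^sup>2) = (n - d\<^sup>2) (n - D\<^sup>2) (s\<^sup>2 - n)\<close>, and every factor is a norm for the extension by
  \<open>\<surd>n\<close>: the number \<open>n w\<close> is the norm of \<open>n + \<surd>n\<close>, and the product \<open>(n - d\<^sup>2) (n - D\<^sup>2)\<close> that of
  \<open>(d + \<surd>n) (D + \<surd>n)\<close>. Multiplicativity of the norm gives a linear change from \<open>t, S'\<close> to \<open>z1, z2\<close> with
  \<open>z1\<^sup>2 - n z2\<^sup>2 = s\<^sup>2 - n\<close> (\<open>norm_equation_solved\<close>). This determines \<open>n\<close> from \<open>s, z1, z2\<close>, whence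
  \<open>x12, s, d, D, z1, z2\<close> generate the function field (\<open>coordinates_mem\<close>, \<open>cm_ext_generated\<close>).

  The constants enter only when \<open>y\<^sup>2 = \<epsilon> CM\<close> is rewritten as \<open>(\<iota> y)\<^sup>2 = - CM\<close>, which takes a constant with
  \<open>\<iota>\<^sup>2 = - \<epsilon>\<close>: the imaginary unit for \<open>\<epsilon> = 1\<close>, and 1 for \<open>\<epsilon> = - 1\<close> (\<open>CM_variety_rational_if_root\<close>).
  The change of variables divides by several elements of the function field. They are nonzero because
  \<open>- CM\<close> is not a square of a rational function (\<open>minus_CM_not_square\<close>), so that adjoining its square
  root yields a field strictly larger than the rational functions, and because \<open>x34\<close> satisfies no linear relation with the other edges (\<open>nondegenerate\<close>).
\<close>

section \<open>Completing the square in the Cayley--Menger polynomial\<close>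

lemma det_expand_first_row:
  fixes f :: "nat \<times> nat \<Rightarrow> 'a :: comm_ring_1"
  shows "Determinant.det (mat (Suc n) (Suc n) f) =
    (\<Sum>j<Suc n. f (0, j) * (-1) ^ j *
       Determinant.det (mat n n (\<lambda>(i, k). f (Suc i, if k < j then k else Suc k))))"
proof -
  have "mat_delete (mat (Suc n) (Suc n) f) 0 j =
      mat n n (\<lambda>(i, k). f (Suc i, if k < j then k else Suc k))" for j
    by (rule eq_matI) (auto simp: mat_delete_def)
  then show ?thesis
    using laplace_expansion_row[of "mat (Suc n) (Suc n) f" "Suc n" 0]
    by (simp add: cofactor_def mult.assoc del: sum.lessThan_Suc)
qed

text \<open>Expanded so that the final evaluation below meets only entries at literal positions.\<close>

lemma det_3:
  fixes f :: "nat \<times> nat \<Rightarrow> 'a :: comm_ring_1"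
  shows "Determinant.det (mat 3 3 f) =
     f(0,0) * (f(1,1)*f(2,2) - f(1,2)*f(2,1))
   - f(0,1) * (f(1,0)*f(2,2) - f(1,2)*f(2,0))
   + f(0,2) * (f(1,0)*f(2,1) - f(1,1)*f(2,0))"
  by (simp add: numeral_eq_Suc det_expand_first_row algebra_simps)

lemma det_Cayley_Menger:
  fixes a b c p q x :: "'a :: comm_ring_1"
  shows "Determinant.det (mat_of_rows_list 5
     [[0, 1, 1, 1, 1],
        [1, 0, a, b, c],
        [1, a, 0, p, q],
        [1, b, p, 0, x],
        [1, c, q, x, 0]]) = (- (a^2*x + x^2*a + b^2*q+q^2*b + c^2*p+p^2*c)
     + a*b*x + a*c*x+a*p*x+a*q*x
     + b*a*q+ b*c*q+b*p*q+b*x*q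
     + c*a*p+ c*b*p+c*q*p+c*x*p
     - a*b*p - a*c*q - b*c*x - p*q*x) * (2::'a)"
proof -
  define M where "M = [[0, 1, 1, 1, 1], [1, 0, a, b, c], [1, a, 0, p, q], [1, b, p, 0, x], [1, c, q, x, 0]]"
  \<comment> \<open>The entries stay opaque during the expansion; list lookups at symbolic positions are costly.\<close>
  define f where "f = (\<lambda>(i, j). M ! i ! j)"
  have f: "f (i, j) = M ! i ! j" for i j
    by (simp add: f_def)
  have d4: "Determinant.det (mat 4 4 g) = (\<Sum>j<4. g (0, j) * (-1) ^ j *
       Determinant.det (mat 3 3 (\<lambda>(i, k). g (Suc i, if k < j then k else Suc k))))" for g :: "nat \<times> nat \<Rightarrow> 'a"
    using det_expand_first_row[of 3 g] by (simp add: eval_nat_numeral del: sum.lessThan_Suc)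
  have "Determinant.det (mat_of_rows_list 5 M) = Determinant.det (mat (Suc 4) (Suc 4) f)"
    by (simp add: mat_of_rows_list_def M_def f_def eval_nat_numeral del: nth_Cons_Suc)
  also have "\<dots> = (\<Sum>j<5. f (0, j) * (-1) ^ j *
       Determinant.det (mat 4 4 (\<lambda>(i, k). f (Suc i, if k < j then k else Suc k))))"
    by (subst det_expand_first_row) simp
  also have "\<dots> = (\<Sum>j<5. f (0, j) * (-1) ^ j * (\<Sum>l<4. f (1, if l < j then l else Suc l) * (-1) ^ l *
       Determinant.det (mat 3 3 (\<lambda>(i, k). f (Suc (Suc i), 
         if (if k < l then k else Suc k) < j then (if k < l then k else Suc k) else Suc (if k < l then k else Suc k))))))"
    unfolding d4 by simp
  also have "\<dots> = (- (a^2*x + x^2*a + b^2*q+q^2*b + c^2*p+p^2*c)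
     + a*b*x + a*c*x+a*p*x+a*q*x
     + b*a*q+ b*c*q+b*p*q+b*x*q
     + c*a*p+ c*b*p+c*q*p+c*x*p
     - a*b*p - a*c*q - b*c*x - p*q*x) * (2::'a)"
    unfolding det_3
    by (simp add: eval_nat_numeral, simp add: f M_def, simp add: algebra_simps)
  finally show ?thesis unfolding M_def .
qed

lemma Heron_product:
  fixes a b p :: "'a :: field_char_0"
  shows "((b + p)\<^sup>2 - a\<^sup>2) * (a\<^sup>2 - (b - p)\<^sup>2) = 4 * a\<^sup>2 * b\<^sup>2 - (a\<^sup>2 + b\<^sup>2 - p\<^sup>2)\<^sup>2"
  by (simp add: algebra_simps power2_eq_square)

text \<open>
  As a quadratic in \<open>x\<^sup>2\<close>, the squared length of the edge opposite to \<open>a\<close>, the Cayley--Menger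
  polynomial has leading coefficient \<open>- a\<^sup>2\<close>, and its discriminant splits into the Heron products of
  the two faces through \<open>a\<close>: the two dihedral positions with zero volume coincide exactly when
  a face degenerates. Completing the square displays both facts, and in particular that
  \<open>- CM\<close> has a square as its leading coefficient.
\<close>

lemma CM_Heron:
  fixes a b c p q x :: "'a :: field_char_0"
  shows "- (4 * a\<^sup>2 * CM a b c p q x) =
    (2 * a\<^sup>2 * x\<^sup>2 - (2 * a\<^sup>2 * (b\<^sup>2 + c\<^sup>2) - (a\<^sup>2 + b\<^sup>2 - p\<^sup>2) * (a\<^sup>2 + c\<^sup>2 - q\<^sup>2)))\<^sup>2
      - ((b + p)\<^sup>2 - a\<^sup>2) * (a\<^sup>2 - (b - p)\<^sup>2) * (((c + q)\<^sup>2 - a\<^sup>2) * (a\<^sup>2 - (c - q)\<^sup>2))"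
proof -
  have ident: "- (4 * A * (- (A^2*R + R^2*A + B^2*Q+Q^2*B + C^2*P+P^2*C)
     + A*B*R + A*C*R+A*P*R+A*Q*R
     + B*A*Q+ B*C*Q+B*P*Q+B*R*Q
     + C*A*P+ C*B*P+C*Q*P+C*R*P
     - A*B*P - A*C*Q - B*C*R - P*Q*R)) =
    (2 * A * R - (2 * A * (B + C) - (A + B - P) * (A + C - Q)))\<^sup>2
      - (4*A*B - (A+B-P)\<^sup>2) * (4*A*C - (A+C-Q)\<^sup>2)" for A B C P Q R :: 'a
    by (simp add: algebra_simps power2_eq_square)
  have half: "1 / 2 * (z * 2) = z" for z :: 'a
    by simp
  show ?thesis
    unfolding CM_def det_Cayley_Menger Heron_product half by (rule ident)
qed

section \<open>The norm equation\<close>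

text \<open>
  With \<open>q\<close> and \<open>e\<close> fixed, \<open>4 Y\<^sup>2 = 4 h\<^sup>2 - q e\<close> is a hyperbola in \<open>(Y, h)\<close>. Each line \<open>Y + h = const\<close>
  parallel to an asymptote meets it only once, so it is parametrized by \<open>w\<close>.
\<close>

lemma volume_pencil:
  fixes t Y h m q e w :: "'a :: field_char_0"
  assumes "q \<noteq> 0" and "4 * Y\<^sup>2 = 4 * h\<^sup>2 - q * e" and "t\<^sup>2 = 4 * (h + m)" and "w * q = 2 * (Y + h)"
  shows "w * t\<^sup>2 = q * w\<^sup>2 + 4 * m * w + e"
proof -
  have "q * (w * t\<^sup>2) = q * (q * w\<^sup>2 + 4 * m * w + e)"
    using assms(2-4) by Groebner_Basis.algebra
  then show ?thesis using assms(1) by simp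
qed

text \<open>
  For fixed \<open>w, d, D\<close> the first assumption is the equation of a quadric in \<open>(t, S, s)\<close>. The determinant
  of its \<open>(S, s)\<close> part equals \<open>w\<close> times the negative of its constant term, so
  completing the square in \<open>S\<close> yields a proportionality between two values of the
  norm form of \<open>\<surd>n\<close>, where \<open>n = w + 1\<close>.
\<close>

lemma norm_equation:
  fixes t S s d D n w S' :: "'a :: field_char_0"
  assumes "w * t\<^sup>2 = (S\<^sup>2 - 1) * w\<^sup>2 + (s\<^sup>2 + d\<^sup>2 + S\<^sup>2 + D\<^sup>2 - 2 - 2 * s * d * S * D) * w
      + (s\<^sup>2 - 1) * (1 - d\<^sup>2) * (1 - D\<^sup>2)"
    and "n = w + 1" and "n * S' = n * S - d * D * s"
  shows "n * w * (t\<^sup>2 - n * S'\<^sup>2) = (n - d\<^sup>2) * (n - D\<^sup>2) * (s\<^sup>2 - n)"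
proof -
  have "n * w * (t\<^sup>2 - n * S'\<^sup>2) = n * (w * t\<^sup>2) - w * (n * S')\<^sup>2"
    by Groebner_Basis.algebra
  also have "\<dots> = (n - d\<^sup>2) * (n - D\<^sup>2) * (s\<^sup>2 - n)"
    unfolding assms(1,3) unfolding assms(2) by Groebner_Basis.algebra
  finally show ?thesis .
qed

text \<open>
  The factor \<open>n w\<close> is the norm of \<open>n + \<surd>n\<close>, and \<open>P\<close> that of \<open>c1 + c2 \<surd>n\<close>. Dividing yields
  \<open>z1 + z2 \<surd>n = (n + \<surd>n) (t + S' \<surd>n) / (c1 + c2 \<surd>n)\<close>, of norm \<open>s\<^sup>2 - n\<close>. This equation is linear
  in \<open>n\<close>, which is why \<open>n\<close> is a rational function of \<open>z1, z2, s\<close>. The last two conclusions are the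
  components of the inverse substitution.
\<close>

lemma norm_equation_solved:
  fixes t S' s c1 c2 n w P z1 z2 :: "'a :: field_char_0"
  assumes eq: "n * w * (t\<^sup>2 - n * S'\<^sup>2) = P * (s\<^sup>2 - n)"
    and n: "n = w + 1" and P: "P = c1\<^sup>2 - n * c2\<^sup>2" "P \<noteq> 0"
    and z1: "z1 = (n * (t + S') * c1 - n * (t + n * S') * c2) / P"
    and z2: "z2 = ((t + n * S') * c1 - n * (t + S') * c2) / P"
  shows "z1\<^sup>2 - n * z2\<^sup>2 = s\<^sup>2 - n"
    and "c1 * z1 + n * c2 * z2 = n * (t + S')"
    and "c1 * z2 + c2 * z1 = t + n * S'"
proof -
  have Pz: "P * z1 = n * (t + S') * c1 - n * (t + n * S') * c2"
    "P * z2 = (t + n * S') * c1 - n * (t + S') * c2"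
    using P(2) by (simp_all add: z1 z2)
  have "P * (c1 * z1 + n * c2 * z2) = P * (n * (t + S'))"
    using Pz P(1) by Groebner_Basis.algebra
  then show 1: "c1 * z1 + n * c2 * z2 = n * (t + S')" using P(2) by simp
  have "P * (c1 * z2 + c2 * z1) = P * (t + n * S')"
    using Pz P(1) by Groebner_Basis.algebra
  then show 2: "c1 * z2 + c2 * z1 = t + n * S'" using P(2) by simp
  have "P * (z1\<^sup>2 - n * z2\<^sup>2) = (c1 * z1 + n * c2 * z2)\<^sup>2 - n * (c1 * z2 + c2 * z1)\<^sup>2"
    unfolding P(1) by Groebner_Basis.algebra
  also have "\<dots> = n * w * (t\<^sup>2 - n * S'\<^sup>2)"
    unfolding 1 2 unfolding n by Groebner_Basis.algebra
  finally show "z1\<^sup>2 - n * z2\<^sup>2 = s\<^sup>2 - n" using P(2) by (simp add: eq)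
qed

section \<open>Coordinates on the hypersurface\<close>

locale subfield_set =
  fixes T :: "'a :: field_char_0 set"
  assumes one_mem: "1 \<in> T"
    and add_mem: "x \<in> T \<Longrightarrow> y \<in> T \<Longrightarrow> x + y \<in> T"
    and uminus_mem: "x \<in> T \<Longrightarrow> - x \<in> T"
    and mult_mem: "x \<in> T \<Longrightarrow> y \<in> T \<Longrightarrow> x * y \<in> T"
    and inverse_mem: "x \<in> T \<Longrightarrow> inverse x \<in> T"
begin

lemma zero_mem: "0 \<in> T"
  using add_mem[OF one_mem uminus_mem[OF one_mem]] by simp

lemma diff_mem: "x \<in> T \<Longrightarrow> y \<in> T \<Longrightarrow> x - y \<in> T"
  using add_mem[OF _ uminus_mem] by fastforce

lemma divide_mem: "x \<in> T \<Longrightarrow> y \<in> T \<Longrightarrow> x / y \<in> T"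
  by (simp add: divide_inverse mult_mem inverse_mem)

lemma power_mem: "x \<in> T \<Longrightarrow> x ^ k \<in> T"
  by (induction k) (auto simp: one_mem mult_mem)

lemma numeral_mem: "numeral k \<in> T"
proof -
  have "of_nat j \<in> T" for j
    by (induction j) (auto simp: zero_mem one_mem add_mem)
  from this[of "numeral k"] show ?thesis by simp
qed

lemmas mems = zero_mem one_mem add_mem uminus_mem mult_mem diff_mem divide_mem power_mem numeral_mem

end

text \<open>
  Coordinates on \<open>y\<^sup>2 = - CM\<close>: the edge \<open>a\<close> is scaled to length 1, \<open>s, d\<close> and \<open>S, D\<close> are the sums and
  differences of the remaining edges of the two faces through \<open>a\<close>, and \<open>t\<close> is twice the opposite
  edge. The square of half of \<open>t\<close> would be \<open>m\<close> if the faces were perpendicular. The last two coordinates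
  are the components of \<open>z1 + z2 \<surd>n = (n + \<surd>n) (t + S' \<surd>n) / ((d + \<surd>n) (D + \<surd>n))\<close>.
\<close>

locale CM_point =
  fixes a b c p q x y :: "'a :: field_char_0"
  assumes y_square: "y\<^sup>2 = - CM a b c p q x"
    and a_nonzero: "a \<noteq> 0"
    and face_nondegenerate: "(c + q)\<^sup>2 \<noteq> a\<^sup>2"
begin

definition "s = (b + p) / a"
definition "d = (b - p) / a"
definition "S = (c + q) / a"
definition "D = (c - q) / a"
definition "t = 2 * x / a"
definition "Y = y / a ^ 3"
definition "m = (s\<^sup>2 + d\<^sup>2 + S\<^sup>2 + D\<^sup>2 - 2 - 2 * s * d * S * D) / 4"
definition "w = 2 * (Y + (t\<^sup>2 / 4 - m)) / (S\<^sup>2 - 1)"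
definition "n = w + 1"
definition "S' = S - d * D * s / n"
definition "P = (n - d\<^sup>2) * (n - D\<^sup>2)"
definition "z1 = (n * (t + S') * (d * D + n) - n * (t + n * S') * (d + D)) / P"
definition "z2 = ((t + n * S') * (d * D + n) - n * (t + S') * (d + D)) / P"

lemma S_square_neq_1: "S\<^sup>2 \<noteq> 1"
  using face_nondegenerate a_nonzero by (simp add: S_def power_divide)

lemma edges:
  "b = a * (s + d) / 2" "p = a * (s - d) / 2" "c = a * (S + D) / 2" "q = a * (S - D) / 2"
  "x = a * t / 2" "y = a ^ 3 * Y"
  using a_nonzero by (simp_all add: s_def d_def S_def D_def t_def Y_def field_simps)

lemma w_times: "w * (S\<^sup>2 - 1) = 2 * (Y + (t\<^sup>2 / 4 - m))"
  using S_square_neq_1 by (simp add: w_def)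

lemma normalized_volume:
  "4 * Y\<^sup>2 = 4 * (t\<^sup>2 / 4 - m)\<^sup>2 - (S\<^sup>2 - 1) * ((s\<^sup>2 - 1) * (1 - d\<^sup>2) * (1 - D\<^sup>2))"
proof -
  define b' p' c' q' x' where "b' = b / a" and "p' = p / a" and "c' = c / a" and "q' = q / a" and "x' = x / a"
  have e: "b = a * b'" "p = a * p'" "c = a * c'" "q = a * q'" "x = a * x'"
    using a_nonzero by (simp_all add: b'_def p'_def c'_def q'_def x'_def)
  have e': "s = b' + p'" "d = b' - p'" "S = c' + q'" "D = c' - q'" "t = 2 * x'"
    using a_nonzero
    by (simp_all add: s_def d_def S_def D_def t_def b'_def p'_def c'_def q'_def x'_def field_simps)
  define h where "h = t\<^sup>2 / 4 - m"
  have h: "4 * h = t\<^sup>2 - (s\<^sup>2 + d\<^sup>2 + S\<^sup>2 + D\<^sup>2 - 2 - 2 * s * d * S * D)"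
  proof -
    have "k = r / 4 \<Longrightarrow> 4 * (t\<^sup>2 / 4 - k) = t\<^sup>2 - r" for k r :: 'a
      by (simp add: right_diff_distrib mult.commute)
    from this[OF m_def] show ?thesis unfolding h_def .
  qed
  have "4 * a\<^sup>2 * y\<^sup>2 = - (4 * a\<^sup>2 * CM a b c p q x)" by (simp add: y_square)
  also note CM_Heron
  also have "2 * a\<^sup>2 * x\<^sup>2 - (2 * a\<^sup>2 * (b\<^sup>2 + c\<^sup>2) - (a\<^sup>2 + b\<^sup>2 - p\<^sup>2) * (a\<^sup>2 + c\<^sup>2 - q\<^sup>2)) = 2 * a ^ 4 * h"
  proof -
    have "2 * (2 * a\<^sup>2 * x\<^sup>2 - (2 * a\<^sup>2 * (b\<^sup>2 + c\<^sup>2) - (a\<^sup>2 + b\<^sup>2 - p\<^sup>2) * (a\<^sup>2 + c\<^sup>2 - q\<^sup>2))) = a ^ 4 * (4 * h)"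
      unfolding h unfolding e' unfolding e by Groebner_Basis.algebra
    also have "\<dots> = 2 * (2 * a ^ 4 * h)" by simp
    finally show ?thesis unfolding mult_cancel_left by (elim disjE) simp_all
  qed
  also have "((b + p)\<^sup>2 - a\<^sup>2) * (a\<^sup>2 - (b - p)\<^sup>2) * (((c + q)\<^sup>2 - a\<^sup>2) * (a\<^sup>2 - (c - q)\<^sup>2))
      = a ^ 8 * ((S\<^sup>2 - 1) * ((s\<^sup>2 - 1) * (1 - d\<^sup>2) * (1 - D\<^sup>2)))"
    unfolding e' unfolding e by Groebner_Basis.algebra
  finally have "4 * a\<^sup>2 * y\<^sup>2 = (2 * a ^ 4 * h)\<^sup>2 - a ^ 8 * ((S\<^sup>2 - 1) * ((s\<^sup>2 - 1) * (1 - d\<^sup>2) * (1 - D\<^sup>2)))" .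
  then have "4 * a\<^sup>2 * (a ^ 3 * Y)\<^sup>2 = (2 * a ^ 4 * h)\<^sup>2 - a ^ 8 * ((S\<^sup>2 - 1) * ((s\<^sup>2 - 1) * (1 - d\<^sup>2) * (1 - D\<^sup>2)))"
    by (simp only: edges(6)[symmetric])
  then have "a ^ 8 * (4 * Y\<^sup>2) = a ^ 8 * (4 * h\<^sup>2 - (S\<^sup>2 - 1) * ((s\<^sup>2 - 1) * (1 - d\<^sup>2) * (1 - D\<^sup>2)))"
    by Groebner_Basis.algebra
  then show ?thesis using a_nonzero by (simp add: h_def)
qed

lemma norm_form:
  assumes "n \<noteq> 0"
  shows "n * w * (t\<^sup>2 - n * S'\<^sup>2) = P * (s\<^sup>2 - n)"
proof -
  have "t\<^sup>2 = 4 * ((t\<^sup>2 / 4 - m) + m)" by simp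
  from volume_pencil[OF _ normalized_volume this w_times]
  have "w * t\<^sup>2 = (S\<^sup>2 - 1) * w\<^sup>2 + 4 * m * w + (s\<^sup>2 - 1) * (1 - d\<^sup>2) * (1 - D\<^sup>2)"
    using S_square_neq_1 by simp
  then have "w * t\<^sup>2 = (S\<^sup>2 - 1) * w\<^sup>2 + (s\<^sup>2 + d\<^sup>2 + S\<^sup>2 + D\<^sup>2 - 2 - 2 * s * d * S * D) * w
      + (s\<^sup>2 - 1) * (1 - d\<^sup>2) * (1 - D\<^sup>2)"
    by (simp add: m_def)
  moreover have "n * S' = n * S - d * D * s"
    using assms by (simp add: S'_def right_diff_distrib)
  ultimately show ?thesis
    unfolding P_def using n_def norm_equation by blast
qed

lemma P_norm: "P = (d * D + n)\<^sup>2 - n * (d + D)\<^sup>2"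
  unfolding P_def by Groebner_Basis.algebra

lemmas z_equations = norm_equation_solved[OF norm_form n_def P_norm _ z1_def z2_def]

text \<open>
  The denominators do not vanish as soon as \<open>y\<close> is irrational over a subfield \<open>T\<close> that contains the edges.
  Since \<open>y\<close> is a rational function of \<open>w\<close> and the edges, \<open>w\<close> is outside \<open>T\<close> as well. If \<open>z2\<^sup>2\<close> were 1,
  then \<open>z1 = \<plusminus>s\<close> and the inverse substitution would be a linear equation for \<open>w\<close> over \<open>T\<close>; it can only
  be trivial, which is the linear relation between the edges excluded by the last assumption.
\<close>

lemma nondegenerate:
  assumes "subfield_set T"
    and T: "a \<in> T" "b \<in> T" "c \<in> T" "p \<in> T" "q \<in> T" "x \<in> T" and "y \<notin> T"
    and x: "\<And>u v. u\<^sup>2 = 1 \<Longrightarrow> v\<^sup>2 = 1 \<Longrightarrow> 2 * x \<noteq> u * (b + p) + v * (b - p + c - q - a)"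
  shows "w \<noteq> 0" "n \<noteq> 0" "P \<noteq> 0" "z2\<^sup>2 \<noteq> 1"
proof -
  interpret subfield_set T by fact
  have sT: "s \<in> T" "d \<in> T" "S \<in> T" "D \<in> T" "t \<in> T"
    unfolding s_def d_def S_def D_def t_def by (intro mems T)+
  have w: "w \<notin> T"
  proof
    assume wT: "w \<in> T"
    have "Y = w * (S\<^sup>2 - 1) / 2 - t\<^sup>2 / 4 + m"
      unfolding w_times by (simp add: field_simps)
    then have "Y \<in> T" unfolding m_def by (rule ssubst) (intro mems wT sT)
    then have "a ^ 3 * Y \<in> T" by (intro mems T)
    then have "y \<in> T" by (simp only: edges(6)[symmetric])
    with \<open>y \<notin> T\<close> show False by contradiction
  qed
  then show "w \<noteq> 0" using zero_mem by auto
  have n: "n \<notin> T"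
    using w diff_mem[OF _ one_mem, of n] by (auto simp: n_def)
  then show "n \<noteq> 0" using zero_mem by auto
  from n show "P \<noteq> 0"
    unfolding P_def using power_mem[OF sT(2), of 2] power_mem[OF sT(4), of 2] by auto
  show "z2\<^sup>2 \<noteq> 1"
  proof
    assume z2: "z2\<^sup>2 = 1"
    note z = z_equations[OF \<open>n \<noteq> 0\<close> \<open>P \<noteq> 0\<close>]
    have "z1\<^sup>2 = s\<^sup>2" using z(1) z2 by simp
    then have "z1 = 1 * s \<or> z1 = - 1 * s" by (simp add: power2_eq_iff)
    moreover have "1\<^sup>2 = (1 :: 'a)" "(- 1)\<^sup>2 = (1 :: 'a)" by simp_all
    ultimately obtain u where u: "u\<^sup>2 = 1" "z1 = u * s" "u \<in> T"
      using one_mem uminus_mem[OF one_mem] by blast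
    have z2T: "z2 \<in> T"
      using z2 one_mem uminus_mem[OF one_mem] unfolding power2_eq_1_iff by (elim disjE) (simp_all only:)
    define A C where "A = z1 + (d + D - 1) * z2" and "C = d * D * (z1 - z2) - (d + D) * z1"
    have AC: "A \<in> T" "C \<in> T" unfolding A_def C_def u(2) by (intro mems sT u z2T)+
    have "w * (t - A) = A + C"
      using z(2,3) n_def unfolding A_def C_def by Groebner_Basis.algebra
    moreover have "t \<noteq> A"
    proof
      assume "t = A"
      moreover have "a * s = b + p" "a * d = b - p" "a * D = c - q" "a * t = 2 * x"
        using a_nonzero by (simp_all add: s_def d_def D_def t_def)
      ultimately have "2 * x = u * (b + p) + z2 * (b - p + c - q - a)"
        unfolding A_def u(2) by Groebner_Basis.algebra
      with x[OF u(1) z2] show False by contradiction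
    qed
    ultimately have "(A + C) / (t - A) = w" by (simp add: field_simps)
    moreover have "(A + C) / (t - A) \<in> T" by (intro mems AC sT)
    ultimately show False using w by simp
  qed
qed

text \<open>
  Birationality: the edges and \<open>y\<close> are recovered from the six coordinates by field operations,
  beginning with \<open>n\<close>.
\<close>

lemma coordinates_mem:
  assumes "subfield_set T" and nz: "w \<noteq> 0" "n \<noteq> 0" "P \<noteq> 0" "z2\<^sup>2 \<noteq> 1"
    and T: "a \<in> T" "s \<in> T" "d \<in> T" "D \<in> T" "z1 \<in> T" "z2 \<in> T"
  shows "b \<in> T" "c \<in> T" "p \<in> T" "q \<in> T" "x \<in> T" "y \<in> T"
proof -
  interpret subfield_set T by fact
  note z = z_equations[OF nz(2,3)]
  have "n * (z2\<^sup>2 - 1) = z1\<^sup>2 - s\<^sup>2" using z(1) by (simp add: algebra_simps)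
  then have "n = (z1\<^sup>2 - s\<^sup>2) / (z2\<^sup>2 - 1)" using nz(4) by (simp add: field_simps)
  then have nT: "n \<in> T"
    by (rule ssubst) (intro mems T)
  have wT: "w \<in> T" using diff_mem[OF nT one_mem] by (simp add: n_def)
  have a1: "n * (t + S') \<in> T" unfolding z(2)[symmetric] by (intro mems T nT)
  have a2: "t + n * S' \<in> T" unfolding z(3)[symmetric] by (intro mems T nT)
  have "(n * (t + S') - (t + n * S')) / w = t"
    using nz(1) by (simp add: n_def field_simps)
  then have XT: "t \<in> T" using divide_mem[OF diff_mem[OF a1 a2] wT] by (simp only:)
  have "(t + n * S' - t) / n = S'" using nz(2) by simp
  then have S'T: "S' \<in> T" using divide_mem[OF diff_mem[OF a2 XT] nT] by (simp only:)
  have "S = S' + d * D * s / n" by (simp add: S'_def)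
  then have ST: "S \<in> T" by (rule ssubst) (intro mems T nT S'T)
  have mT: "m \<in> T" unfolding m_def by (intro mems T ST)
  have "Y = w * (S\<^sup>2 - 1) / 2 - t\<^sup>2 / 4 + m"
    unfolding w_times by (simp add: field_simps)
  then have YT: "Y \<in> T" by (rule ssubst) (intro mems mT wT ST XT)
  have "a * (s + d) / 2 \<in> T" "a * (s - d) / 2 \<in> T" "a * (S + D) / 2 \<in> T" "a * (S - D) / 2 \<in> T"
    "a * t / 2 \<in> T" "a ^ 3 * Y \<in> T"
    by (intro mems T ST XT YT)+
  then show "b \<in> T" "p \<in> T" "c \<in> T" "q \<in> T" "x \<in> T" "y \<in> T"
    by (simp_all only: edges[symmetric])
qed

end

section \<open>The polynomial is not minus a square\<close>

text \<open>
  A Euclidean descent in place of unique factorization: if \<open>g = p / q\<close> has \<open>g\<^sup>2 = f\<close> and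
  \<open>c p = q k + r\<close>, then also \<open>g = (c f q - k p) / r\<close>, because \<open>c f q = c g p\<close> and \<open>k p = g k q\<close>.
  A denominator of least degree therefore leaves no remainder.
\<close>

lemma rational_square_root_imp_scaled_square:
  fixes f p q :: "'a :: idom poly"
  assumes "q \<noteq> 0" and "p\<^sup>2 = f * q\<^sup>2"
  shows "\<exists>c k. c \<noteq> 0 \<and> smult (c\<^sup>2) f = k\<^sup>2"
  using assms
proof (induction "degree q" arbitrary: p q rule: less_induct)
  case less
  obtain c k r where c: "c \<noteq> 0" and pk: "smult c p = q * k + r" and r: "r = 0 \<or> degree r < degree q"
    using pseudo_mod[OF less.prems(1), of p] by metis
  show ?case
  proof (cases "r = 0")
    case True
    have "smult (c\<^sup>2) f * q\<^sup>2 = (smult c p)\<^sup>2"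
      using less.prems(2) by (simp add: power2_eq_square ac_simps)
    also have "\<dots> = k\<^sup>2 * q\<^sup>2" using pk True by (simp add: power_mult_distrib)
    finally have "smult (c\<^sup>2) f = k\<^sup>2" 
      by (rule iffD1[OF mult_right_cancel, rotated]) (use less.prems(1) in simp)
    then show ?thesis using c by blast
  next
    case False
    define p' where "p' = smult c f * q - k * p"
    have "p' * q = p * r"
    proof -
      have "p' * q = smult c (f * q\<^sup>2) - k * p * q"
        by (simp add: p'_def algebra_simps power2_eq_square)
      also have "\<dots> = smult c p * p - k * p * q" 
        using less.prems(2) by (simp add: power2_eq_square)
      also have "\<dots> = p * r" by (simp add: pk algebra_simps)
      finally show ?thesis .
    qed
    then have "p'\<^sup>2 * q\<^sup>2 = p\<^sup>2 * r\<^sup>2" by (metis power_mult_distrib)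
    then have "p'\<^sup>2 = f * r\<^sup>2"
      using less.prems by simp
    then show ?thesis using less.hyps[of r p'] False r by blast
  qed
qed

text \<open>
  Otherwise \<open>h - k\<close> and \<open>h + k\<close> would be divisors of a nonzero constant, hence constant, and so
  would be their sum \<open>2 h\<close>.
\<close>

lemma square_minus_const_not_square:
  fixes h k :: "'a :: {idom, ring_char_0} poly"
  assumes "degree h > 0" and "d \<noteq> 0"
  shows "h\<^sup>2 - [:d:] \<noteq> k\<^sup>2"
proof
  assume "h\<^sup>2 - [:d:] = k\<^sup>2"
  then have *: "(h - k) * (h + k) = [:d:]"
    by (simp add: algebra_simps power2_eq_square)
  have "h - k \<noteq> 0" "h + k \<noteq> 0"
    using * assms(2) by auto
  then have "degree (h - k) + degree (h + k) = 0"
    using degree_mult_eq[of "h - k" "h + k"] by (simp add: *)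
  then have "degree ((h - k) + (h + k)) = 0"
    using degree_add_le[of "h - k" 0 "h + k"] by simp
  moreover have "degree ((h - k) + (h + k)) = degree h"
    by (simp add: mult_2[symmetric] numeral_poly del: numeral_poly[symmetric])
  ultimately show False using assms(1) by simp
qed

definition edge12 :: "'k :: field_char_0 poly6" where "edge12 = [:[:[:[:[:[:0, 1:]:]:]:]:]:]"
definition edge13 :: "'k :: field_char_0 poly6" where "edge13 = [:[:[:[:[:0, 1:]:]:]:]:]"
definition edge14 :: "'k :: field_char_0 poly6" where "edge14 = [:[:[:[:0, 1:]:]:]:]"
definition edge23 :: "'k :: field_char_0 poly6" where "edge23 = [:[:[:0, 1:]:]:]"
definition edge24 :: "'k :: field_char_0 poly6" where "edge24 = [:[:0, 1:]:]"
definition edge34 :: "'k :: field_char_0 poly6" where "edge34 = [:0, 1:]"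

lemmas edge_defs = edge12_def edge13_def edge14_def edge23_def edge24_def edge34_def

lemma X_to_fract:
  "X12 = to_fract edge12" "X13 = to_fract edge13" "X14 = to_fract edge14"
  "X23 = to_fract edge23" "X24 = to_fract edge24" "X34 = to_fract edge34"
  by (simp_all add: to_fract_def edge_defs X12_def X13_def X14_def X23_def X24_def X34_def)

instance fract :: ("{idom, ring_char_0}") field_char_0
proof
  have "of_nat n = to_fract (of_nat n :: 'a)" for n
    by (induction n) simp_all
  then show "inj (of_nat :: nat \<Rightarrow> 'a fract)"
    by (intro injI) simp
qed

lemma to_fract_power: "to_fract (p ^ n) = to_fract p ^ n"
  by (induction n) simp_all

lemma to_fract_numeral: "to_fract (numeral k) = numeral k"
proof -
  have "to_fract (of_nat j :: 'a) = of_nat j" for j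
    by (induction j) simp_all
  from this[of "numeral k"] show ?thesis by simp
qed

text \<open>
  Up to the square \<open>4 x12\<^sup>2\<close>, the polynomial \<open>- CM\<close> has the form \<open>h\<^sup>2 - d\<close> with \<open>h\<close> of degree 2 in \<open>x34\<close>
  and \<open>d \<noteq> 0\<close> free of \<open>x34\<close>.
\<close>

lemma minus_CM_not_square:
  fixes g :: "'k :: field_char_0 ratfun6"
  shows "g\<^sup>2 \<noteq> - CM X12 X13 X14 X23 X24 X34"
proof
  assume g: "g\<^sup>2 = - CM X12 X13 X14 X23 X24 X34"
  \<comment> \<open>The five edges other than \<open>x34\<close>, in the coefficient ring of the outermost variable.\<close>
  define a :: "'k poly poly poly poly poly" where "a = [:[:[:[:[:0, 1:]:]:]:]:]"
  define b :: "'k poly poly poly poly poly" where "b = [:[:[:[:0, 1:]:]:]:]"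
  define c :: "'k poly poly poly poly poly" where "c = [:[:[:0, 1:]:]:]"
  define p :: "'k poly poly poly poly poly" where "p = [:[:0, 1:]:]"
  define q :: "'k poly poly poly poly poly" where "q = [:0, 1:]"
  define M where "M = 2 * a\<^sup>2 * (b\<^sup>2 + c\<^sup>2) - (a\<^sup>2 + b\<^sup>2 - p\<^sup>2) * (a\<^sup>2 + c\<^sup>2 - q\<^sup>2)"
  define d where "d = ((b + p)\<^sup>2 - a\<^sup>2) * (a\<^sup>2 - (b - p)\<^sup>2) * (((c + q)\<^sup>2 - a\<^sup>2) * (a\<^sup>2 - (c - q)\<^sup>2))"
  define h where "h = [:- M, 0, 2 * a\<^sup>2:]"
  \<comment> \<open>A product of linear forms, each of which is visibly nonzero.\<close>
  have d_factors: "d = ((b + p) - a) * ((b + p) + a) * ((a - (b - p)) * (a + (b - p)))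
      * (((c + q) - a) * ((c + q) + a) * ((a - (c - q)) * (a + (c - q))))"
    unfolding d_def by (simp add: power2_eq_square algebra_simps)
  have d: "d \<noteq> 0"
  proof -
    have "b + p - a \<noteq> 0" "b + p + a \<noteq> 0" "a - (b - p) \<noteq> 0" "a + (b - p) \<noteq> 0"
      "c + q - a \<noteq> 0" "c + q + a \<noteq> 0" "a - (c - q) \<noteq> 0" "a + (c - q) \<noteq> 0"
      by (simp_all add: a_def b_def c_def p_def q_def)
    then show ?thesis
      unfolding d_factors by (simp only: mult_eq_0_iff simp_thms)
  qed
  have a: "a \<noteq> 0" by (simp add: a_def)
  have "h\<^sup>2 - [:d:] =
      (2 * edge12\<^sup>2 * edge34\<^sup>2 - (2 * edge12\<^sup>2 * (edge13\<^sup>2 + edge14\<^sup>2)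
         - (edge12\<^sup>2 + edge13\<^sup>2 - edge23\<^sup>2) * (edge12\<^sup>2 + edge14\<^sup>2 - edge24\<^sup>2)))\<^sup>2
      - ((edge13 + edge23)\<^sup>2 - edge12\<^sup>2) * (edge12\<^sup>2 - (edge13 - edge23)\<^sup>2)
        * (((edge14 + edge24)\<^sup>2 - edge12\<^sup>2) * (edge12\<^sup>2 - (edge14 - edge24)\<^sup>2))"
  proof -
    have e: "edge12 = [:a:]" "edge13 = [:b:]" "edge14 = [:c:]" "edge23 = [:p:]" "edge24 = [:q:]"
      by (simp_all add: edge_defs a_def b_def c_def p_def q_def)
    have "h = 2 * [:a:]\<^sup>2 * edge34\<^sup>2 - [:M:]"
      by (simp add: h_def edge34_def power2_eq_square numeral_poly)
    moreover have "[:M:] = 2 * [:a:]\<^sup>2 * ([:b:]\<^sup>2 + [:c:]\<^sup>2) - ([:a:]\<^sup>2 + [:b:]\<^sup>2 - [:p:]\<^sup>2) * ([:a:]\<^sup>2 + [:c:]\<^sup>2 - [:q:]\<^sup>2)"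
      by (simp add: M_def power2_eq_square numeral_poly mult.commute)
    moreover have "[:d:] = (([:b:] + [:p:])\<^sup>2 - [:a:]\<^sup>2) * ([:a:]\<^sup>2 - ([:b:] - [:p:])\<^sup>2) * ((([:c:] + [:q:])\<^sup>2 - [:a:]\<^sup>2) * ([:a:]\<^sup>2 - ([:c:] - [:q:])\<^sup>2))"
      by (simp add: d_def power2_eq_square)
    ultimately show ?thesis unfolding e by (simp only:)
  qed
  then have "to_fract (h\<^sup>2 - [:d:]) = - (4 * X12\<^sup>2 * CM X12 X13 X14 X23 X24 X34)"
    unfolding X_to_fract CM_Heron
    by (simp only: to_fract_power to_fract_numeral to_fract_mult to_fract_add to_fract_diff)
  also have "\<dots> = (2 * X12 * g)\<^sup>2"
    by (simp add: power_mult_distrib g)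
  finally have "to_fract (h\<^sup>2 - [:d:]) = (2 * X12 * g)\<^sup>2" .
  moreover obtain u v where uv: "2 * X12 * g = Fract u v" "v \<noteq> 0"
    by (cases "2 * X12 * g") auto
  ultimately have "u\<^sup>2 = (h\<^sup>2 - [:d:]) * v\<^sup>2"
    by (simp add: to_fract_def power2_eq_square eq_fract)
  from rational_square_root_imp_scaled_square[OF uv(2) this]
  obtain r k where "r \<noteq> 0" and "smult (r\<^sup>2) (h\<^sup>2 - [:d:]) = k\<^sup>2" by blast
  moreover have "smult (r\<^sup>2) (h\<^sup>2 - [:d:]) = (smult r h)\<^sup>2 - [:r\<^sup>2 * d:]"
    by (simp add: smult_diff_right power2_eq_square)
  moreover have "degree (smult r h) = 2" using \<open>r \<noteq> 0\<close> a by (simp add: h_def)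
  ultimately show False
    using square_minus_const_not_square[of "smult r h" "r\<^sup>2 * d" k] d by simp
qed

section \<open>The function field as a type\<close>

text \<open>
  The element \<open>CM_Ext a b\<close> is \<open>a + b \<eta>\<close> with \<open>\<eta>\<^sup>2 = - CM\<close>. As a type of class \<open>field\<close> it makes the
  coordinate changes accessible to simplification; both hypersurfaces of the theorem have a function
  field isomorphic to it, with \<open>\<eta>\<close> a constant multiple of \<open>y\<close>.
\<close>

typedef (overloaded) 'k cm_ext = "UNIV :: ('k :: field_char_0 ratfun6 \<times> 'k ratfun6) set"
  morphisms parts of_parts by simp

definition CM_Ext :: "'k :: field_char_0 ratfun6 \<Rightarrow> 'k ratfun6 \<Rightarrow> 'k cm_ext" where
  "CM_Ext a b = of_parts (a, b)"

definition base_part :: "'k :: field_char_0 cm_ext \<Rightarrow> 'k ratfun6" where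
  "base_part z = fst (parts z)"

definition root_part :: "'k :: field_char_0 cm_ext \<Rightarrow> 'k ratfun6" where
  "root_part z = snd (parts z)"

lemma CM_Ext_parts [simp]: "base_part (CM_Ext a b) = a" "root_part (CM_Ext a b) = b"
  by (simp_all add: base_part_def root_part_def CM_Ext_def of_parts_inverse)

lemma cm_ext_eqI: "base_part z = base_part z' \<Longrightarrow> root_part z = root_part z' \<Longrightarrow> z = z'"
  by (metis base_part_def root_part_def prod_eq_iff parts_inject)

lemma CM_Ext_collapse [simp]: "CM_Ext (base_part z) (root_part z) = z"
  by (rule cm_ext_eqI) simp_all

lemma CM_Ext_inject [simp]: "CM_Ext a b = CM_Ext a' b' \<longleftrightarrow> a = a' \<and> b = b'"
  by (metis CM_Ext_parts)

abbreviation CM_generic :: "'k :: field_char_0 ratfun6" where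
  "CM_generic \<equiv> CM X12 X13 X14 X23 X24 X34"

lemma cm_norm_nonzero:
  fixes a b :: "'k :: field_char_0 ratfun6"
  assumes "a \<noteq> 0 \<or> b \<noteq> 0"
  shows "a\<^sup>2 + CM_generic * b\<^sup>2 \<noteq> 0"
proof
  assume *: "a\<^sup>2 + CM_generic * b\<^sup>2 = 0"
  with assms have "b \<noteq> 0" by auto
  have "a\<^sup>2 = - CM_generic * b\<^sup>2" using * by (simp add: eq_neg_iff_add_eq_0)
  then have "(a / b)\<^sup>2 = - CM_generic" using \<open>b \<noteq> 0\<close> by (simp add: power_divide)
  then show False using minus_CM_not_square by blast
qed

instantiation cm_ext :: (field_char_0) field
begin

definition "0 = CM_Ext 0 0"
definition "1 = CM_Ext 1 0"
definition "z + z' = CM_Ext (base_part z + base_part z') (root_part z + root_part z')"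
definition "- z = CM_Ext (- base_part z) (- root_part z)"
definition "z - z' = CM_Ext (base_part z - base_part z') (root_part z - root_part z')"
definition "z * z' = CM_Ext (base_part z * base_part z' - CM_generic * (root_part z * root_part z'))
  (base_part z * root_part z' + root_part z * base_part z')"
definition "inverse z = (let N = (base_part z)\<^sup>2 + CM_generic * (root_part z)\<^sup>2
  in CM_Ext (base_part z / N) (- root_part z / N))"
definition "z div z' = z * inverse (z' :: 'a cm_ext)"

lemmas cm_ext_defs = zero_cm_ext_def one_cm_ext_def plus_cm_ext_def uminus_cm_ext_def
  minus_cm_ext_def times_cm_ext_def

instance
proof
  fix z :: "'a cm_ext"
  assume "z \<noteq> 0"
  then have "(base_part z)\<^sup>2 + CM_generic * (root_part z)\<^sup>2 \<noteq> 0"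
    by (intro cm_norm_nonzero) (auto simp: zero_cm_ext_def intro: cm_ext_eqI)
  moreover define N where "N = (base_part z)\<^sup>2 + CM_generic * (root_part z)\<^sup>2"
  ultimately have "N / N = 1" by simp
  then show "inverse z * z = 1"
    unfolding inverse_cm_ext_def N_def[symmetric] Let_def
    by (simp add: cm_ext_defs) (simp add: N_def power2_eq_square add_divide_distrib[symmetric] mult.assoc)
qed (auto simp: cm_ext_defs divide_cm_ext_def inverse_cm_ext_def algebra_simps)

end

lemma parts_arith [simp]:
  fixes z z' :: "'k :: field_char_0 cm_ext"
  shows "base_part (z + z') = base_part z + base_part z'" "root_part (z + z') = root_part z + root_part z'"
    "base_part (z - z') = base_part z - base_part z'" "root_part (z - z') = root_part z - root_part z'"
    "base_part (- z) = - base_part z" "root_part (- z) = - root_part z"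
    "base_part (z * z') = base_part z * base_part z' - CM_generic * (root_part z * root_part z')"
    "root_part (z * z') = base_part z * root_part z' + root_part z * base_part z'"
    "base_part (0 :: 'k cm_ext) = 0" "root_part (0 :: 'k cm_ext) = 0" 
    "base_part (1 :: 'k cm_ext) = 1" "root_part (1 :: 'k cm_ext) = 0"
  by (simp_all add: cm_ext_defs)

definition of_ratfun :: "'k :: field_char_0 ratfun6 \<Rightarrow> 'k cm_ext" where
  "of_ratfun a = CM_Ext a 0"

lemma of_ratfun_hom:
  "of_ratfun 0 = 0" "of_ratfun 1 = 1"
  "of_ratfun (a + b) = of_ratfun a + of_ratfun b" "of_ratfun (a - b) = of_ratfun a - of_ratfun b"
  "of_ratfun (- a) = - of_ratfun a" "of_ratfun (a * b) = of_ratfun a * of_ratfun b"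
  by (simp_all add: of_ratfun_def cm_ext_defs)

lemma of_ratfun_power: "of_ratfun (a ^ n) = of_ratfun a ^ n"
  by (induction n) (simp_all add: of_ratfun_hom)

lemma of_ratfun_inverse: "of_ratfun (inverse a) = inverse (of_ratfun a)"
  by (cases "a = 0") (simp_all add: of_ratfun_def inverse_cm_ext_def power2_eq_square divide_inverse zero_cm_ext_def)

lemma of_ratfun_divide: "of_ratfun (a / b) = of_ratfun a / of_ratfun b"
  by (simp add: divide_inverse of_ratfun_hom of_ratfun_inverse)

lemma of_ratfun_of_nat: "of_ratfun (of_nat n) = of_nat n"
  by (induction n) (simp_all add: of_ratfun_hom)

lemma of_ratfun_eq_iff: "of_ratfun a = of_ratfun b \<longleftrightarrow> a = b"
  by (simp add: of_ratfun_def)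

instance cm_ext :: (field_char_0) field_char_0
proof
  show "inj (of_nat :: nat \<Rightarrow> 'a cm_ext)"
    by (metis injI of_ratfun_of_nat of_ratfun_eq_iff of_nat_eq_iff)
qed

lemma of_ratfun_numeral: "of_ratfun (numeral k) = numeral k"
  using of_ratfun_of_nat[of "numeral k"] by simp

lemma root_part_of_ratfun [simp]: "root_part (of_ratfun a) = 0" "base_part (of_ratfun a) = a"
  by (simp_all add: of_ratfun_def)

definition cm_root :: "'k :: field_char_0 cm_ext" where "cm_root = CM_Ext 0 1"

lemma cm_root_square: "cm_root\<^sup>2 = - of_ratfun CM_generic"
  by (simp add: cm_root_def power2_eq_square of_ratfun_def cm_ext_defs)

lemma root_part_cm_root [simp]: "root_part cm_root = 1"
  by (simp add: cm_root_def)

lemma of_ratfun_eq_0_iff: "of_ratfun a = 0 \<longleftrightarrow> a = 0"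
  by (simp add: of_ratfun_def zero_cm_ext_def)

lemma poly_image_mem:
  fixes f :: "'b :: comm_ring_1 poly \<Rightarrow> 'a :: field_char_0"
  assumes "subfield_set T"
    and add: "\<And>p q. f (p + q) = f p + f q" and mult: "\<And>p q. f (p * q) = f p * f q"
    and const: "\<And>c. f [:c:] \<in> T" and var: "f [:0, 1:] \<in> T"
  shows "f p \<in> T"
proof (induction p)
  case 0
  then show ?case using const[of 0] by simp
next
  case (pCons c p)
  interpret subfield_set T by fact
  have "pCons c p = [:c:] + [:0, 1:] * p" by simp
  then have "f (pCons c p) = f [:c:] + f [:0, 1:] * f p" by (simp only: add mult)
  then show ?case using const var pCons.IH by (simp add: add_mem mult_mem)
qed

text \<open>
  A polynomial in six variables is an iterated polynomial in one variable, so the preceding lemma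
  applies once for each layer of coefficients.
\<close>

lemma of_ratfun_mem:
  fixes T :: "'k :: field_char_0 cm_ext set"
  assumes T: "subfield_set T"
    and const: "\<And>k. of_ratfun (ratfun_const k) \<in> T"
    and vars: "of_ratfun X12 \<in> T" "of_ratfun X13 \<in> T" "of_ratfun X14 \<in> T"
      "of_ratfun X23 \<in> T" "of_ratfun X24 \<in> T" "of_ratfun X34 \<in> T"
  shows "of_ratfun f \<in> T"
proof -
  interpret subfield_set T by fact
  define h where "h p = of_ratfun (to_fract p)" for p :: "'k poly6"
  have add: "h (p + q) = h p + h q" and mult: "h (p * q) = h p * h q" for p q
    by (simp_all add: h_def of_ratfun_hom)
  have h: "h [:[:[:[:[:[:k:]:]:]:]:]:] \<in> T" "h [:[:[:[:[:[:0, 1:]:]:]:]:]:] \<in> T" "h [:[:[:[:[:0, 1:]:]:]:]:] \<in> T"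
    "h [:[:[:[:0, 1:]:]:]:] \<in> T" "h [:[:[:0, 1:]:]:] \<in> T" "h [:[:0, 1:]:] \<in> T" "h [:0, 1:] \<in> T" for k
    using const[of k] vars
    by (simp_all add: h_def ratfun_const_def to_fract_def X12_def X13_def X14_def X23_def X24_def X34_def)
  have "h [:[:[:[:[:p:]:]:]:]:] \<in> T" for p
    using poly_image_mem[OF T, of "\<lambda>p. h [:[:[:[:[:p:]:]:]:]:]"] h
    by (simp add: add[symmetric] mult[symmetric] mult.commute)
  then have "h [:[:[:[:p:]:]:]:] \<in> T" for p
    using poly_image_mem[OF T, of "\<lambda>p. h [:[:[:[:p:]:]:]:]"] h
    by (simp add: add[symmetric] mult[symmetric] mult.commute)
  then have "h [:[:[:p:]:]:] \<in> T" for p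
    using poly_image_mem[OF T, of "\<lambda>p. h [:[:[:p:]:]:]"] h
    by (simp add: add[symmetric] mult[symmetric] mult.commute)
  then have "h [:[:p:]:] \<in> T" for p
    using poly_image_mem[OF T, of "\<lambda>p. h [:[:p:]:]"] h
    by (simp add: add[symmetric] mult[symmetric] mult.commute)
  then have "h [:p:] \<in> T" for p
    using poly_image_mem[OF T, of "\<lambda>p. h [:p:]"] h
    by (simp add: add[symmetric] mult[symmetric] mult.commute)
  then have "h p \<in> T" for p
    using poly_image_mem[OF T, of h] h by (simp add: add mult)
  then have "of_ratfun (to_fract u) / of_ratfun (to_fract v) \<in> T" for u v
    using divide_mem by (simp add: h_def)
  then show ?thesis
    by (cases f) (simp add: Fract_conv_to_fract of_ratfun_divide)
qed

lemma subfield_set_range_of_ratfun: "subfield_set (range of_ratfun)"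
proof
  show "1 \<in> range of_ratfun" using of_ratfun_hom(2) by (metis rangeI)
next
  fix z z' :: "'a cm_ext"
  assume "z \<in> range of_ratfun" "z' \<in> range of_ratfun"
  then show "z + z' \<in> range of_ratfun" "z * z' \<in> range of_ratfun"
    by (auto simp: of_ratfun_hom(3,6)[symmetric])
next
  fix z :: "'a cm_ext"
  assume "z \<in> range of_ratfun"
  then show "- z \<in> range of_ratfun" "inverse z \<in> range of_ratfun"
    by (auto simp: of_ratfun_hom(5)[symmetric] of_ratfun_inverse[symmetric])
qed

lemma of_ratfun_CM:
  assumes "a \<noteq> 0"
  shows "of_ratfun (CM a b c p q x) = CM (of_ratfun a) (of_ratfun b) (of_ratfun c) (of_ratfun p) (of_ratfun q) (of_ratfun x)"
proof -
  have "of_ratfun (- (4 * a\<^sup>2 * CM a b c p q x)) = - (4 * (of_ratfun a)\<^sup>2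
      * CM (of_ratfun a) (of_ratfun b) (of_ratfun c) (of_ratfun p) (of_ratfun q) (of_ratfun x))"
    unfolding CM_Heron by (simp only: of_ratfun_hom of_ratfun_power of_ratfun_numeral)
  then show ?thesis
    using assms by (simp add: of_ratfun_hom of_ratfun_power of_ratfun_numeral of_ratfun_eq_0_iff)
qed

section \<open>The generic point\<close>

interpretation generic: CM_point "of_ratfun X12" "of_ratfun X13" "of_ratfun X14"
  "of_ratfun X23" "of_ratfun X24" "of_ratfun X34" "cm_root :: 'k :: field_char_0 cm_ext"
proof
  have X12: "X12 \<noteq> (0 :: 'k ratfun6)" by (simp add: X_to_fract edge_defs)
  show "cm_root\<^sup>2 = - CM (of_ratfun X12) (of_ratfun X13) (of_ratfun X14) (of_ratfun X23) (of_ratfun X24) (of_ratfun (X34 :: 'k ratfun6))"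
    by (simp add: cm_root_square of_ratfun_CM[OF X12, symmetric])
  show "of_ratfun X12 \<noteq> (0 :: 'k cm_ext)"
    using X12 by (simp add: of_ratfun_eq_0_iff)
  have "(edge14 + edge24 - edge12) \<noteq> (0 :: 'k poly6)" "(edge14 + edge24 + edge12) \<noteq> (0 :: 'k poly6)"
    by (simp_all add: edge_defs)
  then have "(edge14 + edge24 - edge12) * (edge14 + edge24 + edge12) \<noteq> (0 :: 'k poly6)"
    by (simp only: mult_eq_0_iff simp_thms)
  then have "(edge14 + edge24)\<^sup>2 \<noteq> (edge12 :: 'k poly6)\<^sup>2"
    by (simp add: power2_eq_square algebra_simps)
  then have "(X14 + X24)\<^sup>2 \<noteq> (X12 :: 'k ratfun6)\<^sup>2"
    unfolding X_to_fract to_fract_add[symmetric] to_fract_power[symmetric] by simp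
  then show "(of_ratfun X14 + of_ratfun X24)\<^sup>2 \<noteq> (of_ratfun X12 :: 'k cm_ext)\<^sup>2"
    by (simp add: of_ratfun_hom(3)[symmetric] of_ratfun_power[symmetric] of_ratfun_eq_iff)
qed

lemma generic_nondegenerate:
  "generic.w \<noteq> (0 :: 'k :: field_char_0 cm_ext)" "generic.n \<noteq> (0 :: 'k cm_ext)"
  "generic.P \<noteq> (0 :: 'k cm_ext)" "generic.z2\<^sup>2 \<noteq> (1 :: 'k cm_ext)"
proof -
  have root: "cm_root \<notin> range (of_ratfun :: 'k ratfun6 \<Rightarrow> _)"
    using root_part_cm_root root_part_of_ratfun(1) by (metis rangeE zero_neq_one)
  have e: "2 * edge34 \<noteq> u * (edge13 + edge23) + v * (edge13 - edge23 + edge14 - edge24 - (edge12 :: 'k poly6))"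
    if "u = 1 \<or> u = - 1" "v = 1 \<or> v = - 1" for u v
    using that by (elim disjE) (simp_all add: edge_defs numeral_poly)
  have "2 * of_ratfun X34 \<noteq> u * (of_ratfun X13 + of_ratfun X23)
      + v * (of_ratfun X13 - of_ratfun X23 + of_ratfun X14 - of_ratfun X24 - (of_ratfun X12 :: 'k cm_ext))"
    if uv: "u\<^sup>2 = 1" "v\<^sup>2 = 1" for u v
  proof -
    have "\<exists>k :: 'k poly6. (k = 1 \<or> k = - 1) \<and> u = of_ratfun (to_fract k)" if "u\<^sup>2 = 1" for u
      using that unfolding power2_eq_1_iff
      by (metis of_ratfun_hom(2,5) to_fract_1 to_fract_uminus)
    with uv obtain k l :: "'k poly6" where "k = 1 \<or> k = - 1" "u = of_ratfun (to_fract k)"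
      "l = 1 \<or> l = - 1" "v = of_ratfun (to_fract l)"
      by blast
    with e[of k l] show ?thesis
      unfolding X_to_fract
      by (simp only: of_ratfun_hom[symmetric] of_ratfun_numeral[symmetric] to_fract_numeral[symmetric]
          to_fract_add[symmetric] to_fract_diff[symmetric] to_fract_mult[symmetric] of_ratfun_eq_iff to_fract_eq_iff)
        blast
  qed
  from generic.nondegenerate[OF subfield_set_range_of_ratfun _ _ _ _ _ _ root this]
  show "generic.w \<noteq> (0 :: 'k cm_ext)" "generic.n \<noteq> (0 :: 'k cm_ext)"
    "generic.P \<noteq> (0 :: 'k cm_ext)" "generic.z2\<^sup>2 \<noteq> (1 :: 'k cm_ext)"
    by blast+
qed

lemma cm_ext_generated:
  fixes T :: "'k :: field_char_0 cm_ext set"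
  assumes T: "subfield_set T" and const: "\<And>k. of_ratfun (ratfun_const k) \<in> T"
    and gens: "of_ratfun X12 \<in> T" "generic.s \<in> T" "generic.d \<in> T" "generic.D \<in> T"
      "generic.z1 \<in> T" "generic.z2 \<in> T"
  shows "z \<in> T"
proof -
  interpret subfield_set T by fact
  note mem = generic.coordinates_mem[OF T generic_nondegenerate gens]
  have "z = of_ratfun (base_part z) + of_ratfun (root_part z) * cm_root"
    by (rule cm_ext_eqI) (simp_all add: cm_root_def)
  also have "\<dots> \<in> T"
    using of_ratfun_mem[OF T const gens(1) mem(1,2,3,4,5)] mem(6) by (intro mems)
  finally show ?thesis .
qed

section \<open>Transport to the quotient ring\<close>

lemma type_algebra_simps:
  "carrier ring_of_type_algebra = UNIV" "x \<otimes>\<^bsub>ring_of_type_algebra\<^esub> y = x * y"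
  "x \<oplus>\<^bsub>ring_of_type_algebra\<^esub> y = x + y" "\<zero>\<^bsub>ring_of_type_algebra\<^esub> = 0" "\<one>\<^bsub>ring_of_type_algebra\<^esub> = 1"
  by (simp_all add: ring_of_type_algebra_def)

text \<open>
  Inverses in \<open>L\<close> need no separate proof that \<open>L\<close> is a field: a nonzero \<open>\<psi> u\<close> comes from a nonzero \<open>u\<close>
  and is inverted by \<open>\<psi> (inverse u)\<close>.
\<close>

lemma generate_field_image:
  fixes \<psi> :: "'a :: field_char_0 \<Rightarrow> 'b" and L :: "'b ring"
  assumes "cring L" and hom: "\<psi> \<in> Ring.ring_hom ring_of_type_algebra L" and surj: "range \<psi> = carrier L"
    and gen: "\<And>T z. subfield_set T \<Longrightarrow> G \<subseteq> T \<Longrightarrow> z \<in> T"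
  shows "carrier L = generate_field L (\<psi> ` G)"
proof -
  interpret L: cring L by fact
  have closed: "\<psi> z \<in> carrier L" for z using surj by blast
  have add: "\<psi> (u + v) = \<psi> u \<oplus>\<^bsub>L\<^esub> \<psi> v" and mult: "\<psi> (u * v) = \<psi> u \<otimes>\<^bsub>L\<^esub> \<psi> v"
    and one: "\<psi> 1 = \<one>\<^bsub>L\<^esub>" for u v
    using hom by (simp_all add: Ring.ring_hom_def type_algebra_simps)
  have zero: "\<psi> 0 = \<zero>\<^bsub>L\<^esub>"
    using add[of 0 0] closed[of 0] L.add.l_cancel_one[of "\<psi> 0" "\<psi> 0"] by simp
  have uminus: "\<psi> (- u) = \<ominus>\<^bsub>L\<^esub> \<psi> u" for u
    using L.minus_equality[of "\<psi> (- u)" "\<psi> u"] closed add[of "- u" u] zero by simp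
  have inverse: "\<psi> (inverse u) = inv\<^bsub>L\<^esub> \<psi> u" if "\<psi> u \<noteq> \<zero>\<^bsub>L\<^esub>" for u
  proof -
    have "u \<noteq> 0" using that zero by auto
    then have "\<psi> u \<otimes>\<^bsub>L\<^esub> \<psi> (inverse u) = \<one>\<^bsub>L\<^esub>" by (simp add: mult[symmetric] one)
    then show ?thesis using L.comm_inv_char closed by metis
  qed
  have "subfield_set {z. \<psi> z \<in> generate_field L (\<psi> ` G)}"
  proof
    fix z
    assume z: "z \<in> {z. \<psi> z \<in> generate_field L (\<psi> ` G)}"
    show "inverse z \<in> {z. \<psi> z \<in> generate_field L (\<psi> ` G)}"
    proof (cases "\<psi> z = \<zero>\<^bsub>L\<^esub>")
      case True
      \<comment> \<open>If \<open>\<psi> z = 0\<close> then \<open>\<psi> (inverse z) = 0\<close>, also in the trivial ring.\<close>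
      have "inverse z = z * (inverse z)\<^sup>2" by (cases "z = 0") (simp_all add: power2_eq_square)
      then have "\<psi> (inverse z) = \<psi> z \<otimes>\<^bsub>L\<^esub> \<psi> ((inverse z)\<^sup>2)" by (metis mult)
      also have "\<dots> = \<psi> z" using True closed by simp
      finally show ?thesis using z by simp
    next
      case False
      with z have "inv\<^bsub>L\<^esub> \<psi> z \<in> generate_field L (\<psi> ` G)" by (simp add: generate_field.m_inv)
      then show ?thesis by (simp add: inverse[OF False])
    qed
  qed (auto simp: one add uminus mult intro: generate_field.intros)
  moreover have "G \<subseteq> {z. \<psi> z \<in> generate_field L (\<psi> ` G)}"
    by (auto intro: generate_field.incl)
  ultimately have gen_mem: "\<psi> z \<in> generate_field L (\<psi> ` G)" for z
    using gen by blast
  have mem_range: "h \<in> range \<psi>" if "h \<in> generate_field L (\<psi> ` G)" for h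
    using that
  proof (induction rule: generate_field.induct)
    case (m_inv h)
    then obtain u where "h = \<psi> u" by blast
    then show ?case using inverse m_inv.hyps(2) by (metis rangeI)
  qed (auto simp: one[symmetric] add[symmetric] mult[symmetric] uminus[symmetric])
  have "range \<psi> \<subseteq> generate_field L (\<psi> ` G)" by (rule image_subsetI) (rule gen_mem)
  moreover have "generate_field L (\<psi> ` G) \<subseteq> range \<psi>" by (rule subsetI) (rule mem_range)
  ultimately show ?thesis unfolding surj by (rule equalityI)
qed

lemma ratfun_const_square: "ratfun_const (k\<^sup>2) = (ratfun_const k)\<^sup>2"
  by (simp add: ratfun_const_def power2_eq_square)

lemma ratfun_const_1: "ratfun_const 1 = 1"
  by (simp add: ratfun_const_def One_fract_def one_pCons)

lemma ratfun_const_uminus: "ratfun_const (- k) = - ratfun_const k"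
  by (simp add: ratfun_const_def)

text \<open>
  In both cases of the assumption \<open>\<iota>\<^sup>2 = - \<epsilon>\<close>, so that \<open>\<iota> y\<close> is a square root of \<open>- CM\<close>
  when \<open>y\<^sup>2 = \<epsilon> CM\<close>. Sending \<open>\<eta>\<close> to \<open>\<iota> y\<close> transports the generators.
\<close>

lemma CM_variety_rational_if_root:
  fixes \<iota> :: "'k :: field_char_0"
  assumes \<epsilon>: "\<epsilon> = 1 \<and> \<iota>\<^sup>2 = - 1 \<or> \<epsilon> = - 1 \<and> \<iota>\<^sup>2 = 1"
  shows "CM_variety_rational TYPE('k) \<epsilon>"
proof -
  define R where "R = (ratfun_ring :: 'k ratfun6 ring)"
  define f where "f = (CM_hypersurface \<epsilon> :: 'k ratfun6 list)"
  define L where "L = (CM_function_field \<epsilon> :: 'k ratfun6 list set ring)"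
  define j where "j = ratfun_const \<iota>"
  define cm where "cm = (CM_generic :: 'k ratfun6)"
  interpret R: field R unfolding R_def by (rule field_from_type_algebra)
  have "j * j = - of_int \<epsilon>"
    unfolding j_def power2_eq_square[symmetric] ratfun_const_square[symmetric]
    using \<epsilon> by (auto simp: ratfun_const_1 ratfun_const_uminus)
  then have j: "j * j * (of_int \<epsilon> * cm) = - cm" "j \<noteq> 0"
    using \<epsilon> by auto
  have carrier_R: "carrier R = UNIV" by (simp add: R_def type_algebra_simps)
  have f: "f \<in> carrier ((carrier R)[X]\<^bsub>R\<^esub>)"
    unfolding univ_poly_carrier[symmetric] polynomial_def
    by (simp add: f_def CM_hypersurface_def R_def type_algebra_simps)
  define \<kappa> where "\<kappa> = R.rupture_surj (carrier R) f \<circ> R.poly_of_const"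
  define Y where "Y = R.rupture_surj (carrier R) f X\<^bsub>R\<^esub>"
  have L: "L = Rupt\<^bsub>R\<^esub> (carrier R) f"
    by (simp add: L_def CM_function_field_def f_def R_def)
  note surj_hom = R.rupture_surj_hom[OF R.carrier_is_subring f, folded L]
  interpret UP: domain "(carrier R)[X]\<^bsub>R\<^esub>"
    using R.univ_poly_is_domain[OF R.carrier_is_subring] .
  interpret L: cring L
    unfolding L rupture_def by (intro ideal.quotient_is_cring UP.cgenideal_ideal f UP.is_cring)
  interpret Hom: ring_hom_ring "(carrier R)[X]\<^bsub>R\<^esub>" L "R.rupture_surj (carrier R) f"
    using surj_hom(2) .
  have "\<kappa> \<in> Ring.ring_hom R L"
    using R.rupture_surj_norm_is_hom[OF R.carrier_is_subring f] by (simp add: \<kappa>_def L)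
  then have \<kappa>_closed: "\<kappa> u \<in> carrier L" and \<kappa>_add: "\<kappa> (u + v) = \<kappa> u \<oplus>\<^bsub>L\<^esub> \<kappa> v"
    and \<kappa>_mult: "\<kappa> (u * v) = \<kappa> u \<otimes>\<^bsub>L\<^esub> \<kappa> v" and \<kappa>_1: "\<kappa> 1 = \<one>\<^bsub>L\<^esub>" for u v
    by (auto simp add: Ring.ring_hom_def R_def type_algebra_simps)
  have \<kappa>_0: "\<kappa> 0 = \<zero>\<^bsub>L\<^esub>"
    using \<kappa>_add[of 0 0] \<kappa>_closed[of 0] L.add.l_cancel_one[of "\<kappa> 0" "\<kappa> 0"] by simp
  have Y_closed: "Y \<in> carrier L"
    unfolding Y_def using Hom.hom_closed[OF R.var_closed(1)[OF R.carrier_is_subring]] .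
  have Y_square: "Y \<otimes>\<^bsub>L\<^esub> Y = \<kappa> (of_int \<epsilon> * cm)"
  proof -
    have "L.eval (map \<kappa> f) Y = \<zero>\<^bsub>L\<^esub>"
      using R.polynomial_rupture[OF R.carrier_is_subring f] by (simp add: L \<kappa>_def Y_def)
    then have 1: "Y \<otimes>\<^bsub>L\<^esub> Y \<oplus>\<^bsub>L\<^esub> \<kappa> (- (of_int \<epsilon> * cm)) = \<zero>\<^bsub>L\<^esub>"
      using Y_closed \<kappa>_closed by (simp add: f_def CM_hypersurface_def \<kappa>_1 \<kappa>_0 cm_def numeral_2_eq_2)
    have 2: "\<kappa> (of_int \<epsilon> * cm) \<oplus>\<^bsub>L\<^esub> \<kappa> (- (of_int \<epsilon> * cm)) = \<zero>\<^bsub>L\<^esub>"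
      by (simp add: \<kappa>_add[symmetric] \<kappa>_0)
    show ?thesis
      using L.minus_equality[OF 1 \<kappa>_closed L.m_closed[OF Y_closed Y_closed]]
        L.minus_equality[OF 2 \<kappa>_closed \<kappa>_closed] by (rule trans[OF sym])
  qed
  define \<psi> where "\<psi> z = \<kappa> (base_part z) \<oplus>\<^bsub>L\<^esub> \<kappa> (j * root_part z) \<otimes>\<^bsub>L\<^esub> Y" for z
  have \<psi>_hom: "\<psi> \<in> Ring.ring_hom ring_of_type_algebra L"
  proof (rule ring_hom_memI)
    fix z z' :: "'k cm_ext"
    show "\<psi> z \<in> carrier L" using \<kappa>_closed Y_closed by (simp add: \<psi>_def)
    show "\<psi> (z \<oplus>\<^bsub>ring_of_type_algebra\<^esub> z') = \<psi> z \<oplus>\<^bsub>L\<^esub> \<psi> z'"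
      using \<kappa>_closed Y_closed
      by (simp add: \<psi>_def type_algebra_simps \<kappa>_add distrib_left L.l_distr L.a_ac)
    define A B A' B' where "A = \<kappa> (base_part z)" and "B = \<kappa> (j * root_part z)"
      and "A' = \<kappa> (base_part z')" and "B' = \<kappa> (j * root_part z')"
    have in_L: "A \<in> carrier L" "B \<in> carrier L" "A' \<in> carrier L" "B' \<in> carrier L"
      by (simp_all add: A_def B_def A'_def B'_def \<kappa>_closed)
    have "\<kappa> (base_part (z * z')) = A \<otimes>\<^bsub>L\<^esub> A' \<oplus>\<^bsub>L\<^esub> B \<otimes>\<^bsub>L\<^esub> B' \<otimes>\<^bsub>L\<^esub> (Y \<otimes>\<^bsub>L\<^esub> Y)"
    proof -
      have "base_part (z * z') = base_part z * base_part z' - cm * (root_part z * root_part z')"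
        by (simp add: cm_def)
      also have "\<dots> = base_part z * base_part z' + (j * root_part z) * (j * root_part z') * (of_int \<epsilon> * cm)"
        using arg_cong[OF j(1), of "\<lambda>c. c * (root_part z * root_part z')"] by (simp add: algebra_simps)
      finally show ?thesis by (simp only: \<kappa>_add \<kappa>_mult A_def B_def A'_def B'_def Y_square)
    qed
    moreover have "\<kappa> (j * root_part (z * z')) = A \<otimes>\<^bsub>L\<^esub> B' \<oplus>\<^bsub>L\<^esub> B \<otimes>\<^bsub>L\<^esub> A'"
    proof -
      have "j * root_part (z * z') = base_part z * (j * root_part z') + (j * root_part z) * base_part z'"
        by (simp add: algebra_simps)
      then show ?thesis by (simp only: \<kappa>_add \<kappa>_mult A_def B_def A'_def B'_def)
    qed
    ultimately show "\<psi> (z \<otimes>\<^bsub>ring_of_type_algebra\<^esub> z') = \<psi> z \<otimes>\<^bsub>L\<^esub> \<psi> z'"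
      unfolding \<psi>_def type_algebra_simps A_def[symmetric] B_def[symmetric] A'_def[symmetric] B'_def[symmetric]
      using in_L Y_closed by (simp add: L.l_distr L.r_distr L.m_ac L.a_ac)
  next
    show "\<psi> \<one>\<^bsub>ring_of_type_algebra\<^esub> = \<one>\<^bsub>L\<^esub>"
      using Y_closed by (simp add: \<psi>_def type_algebra_simps \<kappa>_0 \<kappa>_1)
  qed
  have \<psi>_base: "\<psi> (of_ratfun u) = \<kappa> u" for u
    using \<kappa>_closed Y_closed by (simp add: \<psi>_def \<kappa>_0)
  have \<psi>_root: "\<psi> (of_ratfun (inverse j) * cm_root) = Y"
    using j(2) \<kappa>_closed Y_closed by (simp add: \<psi>_def \<kappa>_0 \<kappa>_1 cm_root_def)
  have \<psi>_ops: "\<psi> (z * z') = \<psi> z \<otimes>\<^bsub>L\<^esub> \<psi> z'" "\<psi> (z + z') = \<psi> z \<oplus>\<^bsub>L\<^esub> \<psi> z'" for z z'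
    using \<psi>_hom by (simp_all add: Ring.ring_hom_def type_algebra_simps)
  have eval_mem: "L.eval (map \<kappa> q) Y \<in> range \<psi>" for q
  proof (induction q)
    case Nil
    show ?case using \<psi>_base[of 0] by (simp add: \<kappa>_0) (metis rangeI)
  next
    case (Cons u q)
    have "Y [^]\<^bsub>L\<^esub> k \<in> range \<psi>" for k :: nat
    proof (induction k)
      case 0
      show ?case using \<psi>_base[of 1] by (simp add: \<kappa>_1) (metis rangeI)
    next
      case (Suc k)
      then obtain v where "Y [^]\<^bsub>L\<^esub> k = \<psi> v" by blast
      then show ?case by (simp add: \<psi>_root[symmetric] \<psi>_ops(1)[symmetric])
    qed
    then obtain v where v: "Y [^]\<^bsub>L\<^esub> length q = \<psi> v" by blast
    from Cons.IH obtain v' where v': "L.eval (map \<kappa> q) Y = \<psi> v'" by blast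
    have "L.eval (map \<kappa> (u # q)) Y = \<psi> (of_ratfun u) \<otimes>\<^bsub>L\<^esub> \<psi> v \<oplus>\<^bsub>L\<^esub> \<psi> v'"
      by (simp add: v v' \<psi>_base)
    also have "\<dots> = \<psi> (of_ratfun u * v + v')" by (simp only: \<psi>_ops)
    finally show ?case by (simp only: rangeI)
  qed
  have mem_range: "z \<in> range \<psi>" if "z \<in> carrier L" for z
  proof -
    have "carrier L = R.rupture_surj (carrier R) f ` carrier ((carrier R)[X]\<^bsub>R\<^esub>)"
      unfolding L rupture_def FactRing_def A_RCOSETS_def' by (simp add: UNION_singleton_eq_range)
    with that obtain q where q: "q \<in> carrier ((carrier R)[X]\<^bsub>R\<^esub>)" "z = R.rupture_surj (carrier R) f q"
      by blast
    have "L.eval (map \<kappa> q) Y = R.rupture_surj (carrier R) f (UP.eval (map R.poly_of_const q) X\<^bsub>R\<^esub>)"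
      using Hom.eval_hom[OF UP.carrier_is_subring R.var_closed(1)[OF R.carrier_is_subring]
          R.map_norm_in_poly_ring_carrier[OF R.carrier_is_subring q(1)]]
      by (simp add: \<kappa>_def Y_def)
    also have "\<dots> = z" unfolding R.eval_rewrite[OF R.carrier_is_subring q(1), symmetric] by (rule q(2)[symmetric])
    finally show ?thesis using eval_mem[of q] by (simp only:)
  qed
  have \<psi>_closed: "\<psi> z \<in> carrier L" for z
    unfolding \<psi>_def by (intro L.a_closed L.m_closed \<kappa>_closed Y_closed)
  have range_\<psi>: "range \<psi> = carrier L"
  proof
    show "range \<psi> \<subseteq> carrier L" by (rule image_subsetI) (rule \<psi>_closed)
    show "carrier L \<subseteq> range \<psi>" by (rule subsetI) (rule mem_range)
  qed
  define G :: "'k cm_ext set" where "G = range (\<lambda>k. of_ratfun (ratfun_const k))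
    \<union> {of_ratfun X12, generic.s, generic.d, generic.D, generic.z1, generic.z2}"
  have "carrier L = generate_field L (\<psi> ` G)"
  proof (rule generate_field_image[OF L.is_cring \<psi>_hom range_\<psi>])
    fix T :: "'k cm_ext set" and z
    assume T: "subfield_set T" and "G \<subseteq> T"
    show "z \<in> T" by (rule cm_ext_generated[OF T]) (use \<open>G \<subseteq> T\<close> in \<open>auto simp: G_def\<close>)
  qed
  also have "\<psi> ` G = range (CM_function_field_const \<epsilon> :: 'k \<Rightarrow> _)
    \<union> {\<psi> (of_ratfun X12), \<psi> generic.s, \<psi> generic.d, \<psi> generic.D, \<psi> generic.z1, \<psi> generic.z2}"
  proof -
    have "\<psi> (of_ratfun (ratfun_const k)) = CM_function_field_const \<epsilon> k" for k
      by (simp add: \<psi>_base \<kappa>_def CM_function_field_const_def R_def f_def)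
    then show ?thesis by (simp add: G_def image_Un image_image)
  qed
  finally have generated: "carrier L = generate_field L (range (CM_function_field_const \<epsilon> :: 'k \<Rightarrow> _)
    \<union> {\<psi> (of_ratfun X12), \<psi> generic.s, \<psi> generic.d, \<psi> generic.D, \<psi> generic.z1, \<psi> generic.z2})" .
  show ?thesis
    unfolding CM_variety_rational_def Let_def L_def[symmetric]
    by (rule bexI, rule bexI, rule bexI, rule bexI, rule bexI, rule bexI, rule generated) (rule \<psi>_closed)+
qed

lemma gauss_rat_imaginary_unit: "\<exists>\<iota> :: gauss_rat. \<iota>\<^sup>2 = - 1"
proof
  have "\<i> \<in> Q_adjoin_i" by (rule generate_field.incl) simp
  then show "(Abs_gauss_rat \<i>)\<^sup>2 = - 1"
    by (simp add: power2_eq_square Rep_gauss_rat_inject[symmetric] times_gauss_rat.rep_eq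
        uminus_gauss_rat.rep_eq one_gauss_rat.rep_eq Abs_gauss_rat_inverse)
qed

theorem mainTheorem1:
  shows "CM_variety_rational TYPE(gauss_rat) 1 \<and> CM_variety_rational TYPE(rat) (-1)"
proof
  from gauss_rat_imaginary_unit show "CM_variety_rational TYPE(gauss_rat) 1"
    by (metis CM_variety_rational_if_root)
  show "CM_variety_rational TYPE(rat) (- 1)"
    by (rule CM_variety_rational_if_root[where \<iota> = 1]) simp
qed

end
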